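(* Let $(F,L,P,\gamma)$ be a linear networked control system with transfer function $S$ (as defined in the context), and let $1\le k'\le k$. The average sum-rate $\mathcal{R}_s$ (in bits per sample) of any $(k,k')$ stabilizing code based on independent encodings for the system $(F,L,P,\gamma)$ is lower bounded as $$\mathcal{R}_s\ \ge\ \frac{k}{2}\log_2\!\Big(1+\frac{\|S-1\|^2}{k'}\Big).$$
   Context: System. $P$ is an open-loop unstable discrete-time LTI plant with $\begin{bmatrix} e \\ y \end{bmatrix}=\begin{bmatrix} P_{11} & P_{12} \\ P_{21} & P_{22} \end{bmatrix}\begin{bmatrix} d \\ u \end{bmatrix}$, where $u$ and $y$ are scalar and $d$ is the Gaussian disturbance. The feedback loop is $u=Fw$, $w=v+q$, $v=L_wz^{-1}w+L_yy$, with $F$ and $L=[L_w,L_y]$ proper LTI filters making the loop internally stable and well posed, $z^{-1}$ the one-step delay, and $q$ additive white zero-mean coding noise of variance $\sigma_q^2$. $S=(1-L_wz^{-1}-P_{22}FL_y)^{-1}$; $\|\cdot\|$ is the $H_2$ norm, $\|X\|^2=\frac1{2\pi}\int_{-\pi}^{\pi}\mathrm{tr}(X(e^{j\omega})^*X(e^{j\omega}))\,d\omega$. $\gamma=\sigma_v^2/\sigma_q^2$ where $\sigma_v^2$ is the stationary variance of $v$. $(F,L,P,\gamma)$ denotes such a system. Code. A $(k,k')$ code based on independent encodings consists of $k$ descriptions $y_i=v+q_i$, $i=1,\dots,k$, of the Gaussian signal $v$, where the $q_i$ are independent of $v$, mutually independent, zero-mean, with common variance $\sigma^2>0$ (so $y_i,y_j$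 are conditionally independent given $v$). Using $k'$ descriptions means using their average, which has signal-to-noise ratio $k'\sigma_v^2/\sigma^2$. The code is $(k,k')$ stabilizing if using any $k'$ of the descriptions stabilizes the system, the criterion being that the resulting signal-to-noise ratio is at least the minimum (critical) SNR $\|S-1\|^2$ needed for stability. Rates. The average data rate of each description, $\mathcal{R}^{(j)}$, is bounded below by the ideal rate at its signal-to-noise ratio, $\mathcal{R}^{(j)}\ge\frac12\log_2(1+\sigma_v^2/\sigma^2)$, and the average sum-rate is $\mathcal{R}_s=\sum_{j=1}^k\mathcal{R}^{(j)}$. *)

theory Defs
  imports "HOL-Probability.Probability" "HOL-Computational_Algebra.Formal_Power_Series"
begin

text \<open>
  A proper (i.e. causal) discrete-time LTI transfer function
  \<open>H(z) = \<Sum>n. h n * z^(-n)\<close> is represented by the formal power series of its impulse response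
  in the variable \<open>z^(-1)\<close>; hence \<open>fps_X\<close> is the one-step delay and properness is built
  into the type.  No rationality is assumed.  Signals on the time axis \<open>0, 1, 2, ...\<close> are
  represented in the same way, so that filtering (from rest) is multiplication.  This makes sense
  for unstable transfer functions as well.
\<close>

subsection \<open>Plants, filters and the feedback loop\<close>

record ('d, 'e) ncs =
  P11 :: "real fps ^ 'd::finite ^ 'e::finite"
  P12 :: "real fps ^ 'e"
  P21 :: "real fps ^ 'd"
  P22 :: "real fps"
  filter_F :: "real fps"
  filter_Lw :: "real fps"
  filter_Ly :: "real fps"
  gam :: real

text \<open>
  The signals \<open>ru\<close>, \<open>ry\<close>, \<open>rw\<close> are perturbations injected at the plant input, at the plant
  output and in the delayed feedback path; they vanish in the actual system and only serve to
  define internal stability (a perturbation between \<open>L\<close> and \<open>F\<close> is already provided by \<open>q\<close>).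
\<close>

definition closed_loop ::
  "('d::finite, 'e::finite) ncs \<Rightarrow> real fps ^ 'd \<Rightarrow> real fps \<Rightarrow> real fps \<Rightarrow> real fps \<Rightarrow> real fps \<Rightarrow>
   real fps ^ 'e \<Rightarrow> real fps \<Rightarrow> real fps \<Rightarrow> real fps \<Rightarrow> real fps \<Rightarrow> bool" where
  "closed_loop N d q ru ry rw e y u v w \<longleftrightarrow>
     e = P11 N *v d + (\<chi> i. (P12 N $ i) * u) \<and>
     y = (\<Sum>i\<in>UNIV. (P21 N $ i) * (d $ i)) + P22 N * u + ry \<and>
     u = filter_F N * w + ru \<and>
     w = v + q \<and>
     v = filter_Lw N * (fps_X * w + rw) + filter_Ly N * y"

definition bounded_signal :: "real fps \<Rightarrow> bool" where
  "bounded_signal x \<longleftrightarrow> Bseq (fps_nth x)"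

definition bibo_stable :: "real fps \<Rightarrow> bool" where
  "bibo_stable h \<longleftrightarrow> (\<forall>x. bounded_signal x \<longrightarrow> bounded_signal (h * x))"

definition open_loop_unstable :: "('d::finite, 'e::finite) ncs \<Rightarrow> bool" where
  "open_loop_unstable N \<longleftrightarrow>
     \<not> ((\<forall>i j. bibo_stable (P11 N $ i $ j)) \<and> (\<forall>i. bibo_stable (P12 N $ i)) \<and>
        (\<forall>j. bibo_stable (P21 N $ j)) \<and> bibo_stable (P22 N))"

definition return_difference :: "('d::finite, 'e::finite) ncs \<Rightarrow> real fps" where
  "return_difference N = 1 - filter_Lw N * fps_X - P22 N * filter_F N * filter_Ly N"

text \<open>
  The loop equations have a (unique) causal solution for all external inputs iff the return
  difference is a unit, i.e. iff its value at \<open>z = \<infinity>\<close> is nonzero.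
\<close>

definition well_posed :: "('d::finite, 'e::finite) ncs \<Rightarrow> bool" where
  "well_posed N \<longleftrightarrow> fps_nth (return_difference N) 0 \<noteq> 0"

definition internally_stable :: "('d::finite, 'e::finite) ncs \<Rightarrow> bool" where
  "internally_stable N \<longleftrightarrow>
     (\<forall>d q ru ry rw e y u v w.
        closed_loop N d q ru ry rw e y u v w \<longrightarrow>
        (\<forall>i. bounded_signal (d $ i)) \<longrightarrow> bounded_signal q \<longrightarrow>
        bounded_signal ru \<longrightarrow> bounded_signal ry \<longrightarrow> bounded_signal rw \<longrightarrow>
        (\<forall>i. bounded_signal (e $ i)) \<and> bounded_signal y \<and> bounded_signal u \<and>
        bounded_signal v \<and> bounded_signal w)"

definition linear_ncs :: "('d::finite, 'e::finite) ncs \<Rightarrow> bool" where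
  "linear_ncs N \<longleftrightarrow> open_loop_unstable N \<and> well_posed N \<and> internally_stable N"

definition S_tf :: "('d::finite, 'e::finite) ncs \<Rightarrow> real fps" where
  "S_tf N = inverse (return_difference N)"

text \<open>
  \<open>S\<close> enters the loop as expected: without perturbations, \<open>v\<close> responds to \<open>q\<close> through \<open>S - 1\<close>.
\<close>

lemma closed_loop_v:
  assumes "well_posed N" and "closed_loop N d q 0 0 0 e y u v w"
  shows "v = (S_tf N - 1) * q
           + S_tf N * filter_Ly N * (\<Sum>i\<in>UNIV. (P21 N $ i) * (d $ i))"
proof -
  define D where "D = (\<Sum>i\<in>UNIV. (P21 N $ i) * (d $ i))"
  have inv: "S_tf N * return_difference N = 1"
    using assms(1) unfolding S_tf_def well_posed_def by (rule inverse_mult_eq_1)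
  have y: "y = D + P22 N * u + 0" and u: "u = filter_F N * w + 0" and w: "w = v + q"
    and v0: "v = filter_Lw N * (fps_X * w + 0) + filter_Ly N * y"
    using assms(2) unfolding closed_loop_def D_def by blast+
  have v: "v = filter_Lw N * (fps_X * w) + filter_Ly N * (D + P22 N * (filter_F N * w))"
    using v0 unfolding y u add_0_right .
  have "return_difference N * w = w - (filter_Lw N * (fps_X * w) + filter_Ly N * (D + P22 N * (filter_F N * w)))
          + filter_Ly N * D"
    unfolding return_difference_def by (simp add: algebra_simps)
  also have "\<dots> = w - v + filter_Ly N * D"
    by (simp only: v [symmetric])
  also have "\<dots> = q + filter_Ly N * D"
    by (simp add: w)
  finally have "S_tf N * (return_difference N * w) = S_tf N * (q + filter_Ly N * D)" by simp
  then have "w = S_tf N * (q + filter_Ly N * D)"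
    using inv by (simp add: mult.assoc [symmetric])
  moreover have "v = w - q" by (simp add: w)
  ultimately show ?thesis unfolding D_def [symmetric] by (simp add: algebra_simps)
qed

subsection \<open>The \<open>H\<^sub>2\<close> norm\<close>

definition tf_eval :: "real fps \<Rightarrow> complex \<Rightarrow> complex" where
  "tf_eval h z = (\<Sum>n. complex_of_real (fps_nth h n) / z ^ n)"

definition tf_matrix_eval :: "real fps ^ 'n ^ 'm \<Rightarrow> complex \<Rightarrow> complex ^ 'n ^ 'm" where
  "tf_matrix_eval X z = (\<chi> i j. tf_eval (X $ i $ j) z)"

definition conj_transpose :: "complex ^ 'n ^ 'm \<Rightarrow> complex ^ 'm ^ 'n" where
  "conj_transpose A = (\<chi> i j. cnj (A $ j $ i))"

definition h2_norm :: "real fps ^ 'n::finite ^ 'm::finite \<Rightarrow> real" where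
  "h2_norm X =
     sqrt (1 / (2 * pi) *
       integral {-pi..pi}
         (\<lambda>\<omega>. Re (trace (conj_transpose (tf_matrix_eval X (cis \<omega>)) ** tf_matrix_eval X (cis \<omega>)))))"

definition h2_norm_scalar :: "real fps \<Rightarrow> real" where
  "h2_norm_scalar h = h2_norm (mat h :: real fps ^ 1 ^ 1)"

subsection \<open>Random signals\<close>

text \<open>
  A random signal is a map from the sample space to signals; degenerate (constant) random
  variables count as Gaussian.
\<close>

definition gaussian_rv :: "'a measure \<Rightarrow> ('a \<Rightarrow> real) \<Rightarrow> bool" where
  "gaussian_rv M X \<longleftrightarrow> X \<in> borel_measurable M \<and>
     ((\<exists>\<mu>. AE x in M. X x = \<mu>) \<or>
      (\<exists>\<mu> \<sigma>. 0 < \<sigma> \<and> distributed M lborel X (normal_density \<mu> \<sigma>)))"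

definition gaussian_process :: "'a measure \<Rightarrow> ('i \<Rightarrow> 'a \<Rightarrow> real) \<Rightarrow> bool" where
  "gaussian_process M X \<longleftrightarrow>
     (\<forall>I a. finite I \<longrightarrow> gaussian_rv M (\<lambda>x. \<Sum>i\<in>I. a i * X i x))"

definition variance_at :: "'a measure \<Rightarrow> ('a \<Rightarrow> real fps) \<Rightarrow> nat \<Rightarrow> real" where
  "variance_at M x t = prob_space.variance M (\<lambda>\<omega>. fps_nth (x \<omega>) t)"

definition stationary_variance :: "'a measure \<Rightarrow> ('a \<Rightarrow> real fps) \<Rightarrow> real" where
  "stationary_variance M x = lim (variance_at M x)"

definition white_noise :: "'a measure \<Rightarrow> ('a \<Rightarrow> real fps) \<Rightarrow> real \<Rightarrow> bool" where
  "white_noise M q s \<longleftrightarrow>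
     (\<forall>t. (\<lambda>\<omega>. fps_nth (q \<omega>) t) \<in> borel_measurable M \<and>
          integrable M (\<lambda>\<omega>. (fps_nth (q \<omega>) t)\<^sup>2) \<and>
          prob_space.expectation M (\<lambda>\<omega>. fps_nth (q \<omega>) t) = 0 \<and>
          variance_at M q t = s) \<and>
     (\<forall>t t'. t \<noteq> t' \<longrightarrow>
        prob_space.expectation M (\<lambda>\<omega>. fps_nth (q \<omega>) t * fps_nth (q \<omega>) t') = 0)"

text \<open>
  \<open>sv\<close> and \<open>sq\<close> stand for the variances \<open>\<sigma>\<^sub>v\<^sup>2\<close> and \<open>\<sigma>\<^sub>q\<^sup>2\<close>.  The loop is started from rest at time 0,
  so the stationary variance of \<open>v\<close> is the limit of its variances.
\<close>

definition ncs_signals ::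
  "'a measure \<Rightarrow> ('d::finite, 'e::finite) ncs \<Rightarrow> ('a \<Rightarrow> real fps ^ 'd) \<Rightarrow> ('a \<Rightarrow> real fps) \<Rightarrow>
   ('a \<Rightarrow> real fps ^ 'e) \<Rightarrow> ('a \<Rightarrow> real fps) \<Rightarrow> ('a \<Rightarrow> real fps) \<Rightarrow> ('a \<Rightarrow> real fps) \<Rightarrow>
   ('a \<Rightarrow> real fps) \<Rightarrow> real \<Rightarrow> real \<Rightarrow> bool" where
  "ncs_signals M N d q e y u v w sv sq \<longleftrightarrow>
     (\<forall>\<omega>\<in>space M. closed_loop N (d \<omega>) (q \<omega>) 0 0 0 (e \<omega>) (y \<omega>) (u \<omega>) (v \<omega>) (w \<omega>)) \<and>
     gaussian_process M (\<lambda>(i, t) \<omega>. fps_nth (d \<omega> $ i) t) \<and>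
     0 < sq \<and> white_noise M q sq \<and>
     variance_at M v \<longlonglongrightarrow> sv \<and>
     gam N = sv / sq"

subsection \<open>Codes based on independent encodings\<close>

text \<open>
  Independence of the source and the coding noises is required sample by sample: in closed loop,
  \<open>v\<close> may depend on past coding noise.  The source has index 0 in the independent family, so that
  \<open>v\<close> and the noises of the descriptions \<open>1, ..., k\<close> are jointly independent.
\<close>

definition independent_encodings ::
  "'a measure \<Rightarrow> nat \<Rightarrow> ('a \<Rightarrow> real fps) \<Rightarrow> (nat \<Rightarrow> 'a \<Rightarrow> real fps) \<Rightarrow> real \<Rightarrow>
   (nat \<Rightarrow> 'a \<Rightarrow> real fps) \<Rightarrow> bool" where
  "independent_encodings M k v qs s ys \<longleftrightarrow>
     gaussian_process M (\<lambda>t \<omega>. fps_nth (v \<omega>) t) \<and>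
     0 < s \<and>
     (\<forall>i\<in>{1..k}. \<forall>\<omega>\<in>space M. ys i \<omega> = v \<omega> + qs i \<omega>) \<and>
     (\<forall>t. prob_space.indep_vars M (\<lambda>_. borel)
            (\<lambda>i \<omega>. if i = 0 then fps_nth (v \<omega>) t else fps_nth (qs i \<omega>) t) {0..k}) \<and>
     (\<forall>t. \<forall>i\<in>{1..k}.
        integrable M (\<lambda>\<omega>. (fps_nth (qs i \<omega>) t)\<^sup>2) \<and>
        prob_space.expectation M (\<lambda>\<omega>. fps_nth (qs i \<omega>) t) = 0 \<and>
        variance_at M (qs i) t = s)"

definition average_of :: "nat set \<Rightarrow> (nat \<Rightarrow> 'a \<Rightarrow> real fps) \<Rightarrow> 'a \<Rightarrow> real fps" where
  "average_of I ys \<omega> = fps_const (1 / real (card I)) * (\<Sum>i\<in>I. ys i \<omega>)"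

definition snr :: "'a measure \<Rightarrow> ('a \<Rightarrow> real fps) \<Rightarrow> ('a \<Rightarrow> real fps) \<Rightarrow> real" where
  "snr M v x = stationary_variance M v / stationary_variance M (\<lambda>\<omega>. x \<omega> - v \<omega>)"

definition critical_snr :: "('d::finite, 'e::finite) ncs \<Rightarrow> real" where
  "critical_snr N = (h2_norm_scalar (S_tf N - 1))\<^sup>2"

definition stabilizing_code ::
  "'a measure \<Rightarrow> ('d::finite, 'e::finite) ncs \<Rightarrow> nat \<Rightarrow> nat \<Rightarrow> ('a \<Rightarrow> real fps) \<Rightarrow>
   (nat \<Rightarrow> 'a \<Rightarrow> real fps) \<Rightarrow> bool" where
  "stabilizing_code M N k k' v ys \<longleftrightarrow>
     (\<forall>I. I \<subseteq> {1..k} \<and> card I = k' \<longrightarrow> critical_snr N \<le> snr M v (average_of I ys))"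

definition sum_rate :: "nat \<Rightarrow> (nat \<Rightarrow> real) \<Rightarrow> real" where
  "sum_rate k R = (\<Sum>j = 1..k. R j)"

end

theory Submission
  imports Defs
begin

text \<open>
  Averaging \<open>k'\<close> descriptions divides the noise variance by \<open>k'\<close>, so it multiplies the
  signal-to-noise ratio of a single description by \<open>k'\<close>.  Stabilizability therefore forces
  that ratio to be at least \<open>1 / k'\<close> of the critical one, and the ideal rate at
  this ratio, summed over the \<open>k\<close> descriptions, is the bound.
\<close>

text \<open>Expanding the square leaves only the diagonal, because the expectation of a product of
  independent variables factors and each factor of a cross term has mean zero. The three claims go
  through one induction: splitting the expectation of the square needs square-integrability of the
  partial sum.\<close>

lemma (in prob_space) indep_zero_mean_sum_moments:
  fixes X :: "'i \<Rightarrow> 'a \<Rightarrow> real"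
  assumes "finite I"
    and "indep_vars (\<lambda>_. borel) X I"
    and "\<And>i. i \<in> I \<Longrightarrow> integrable M (\<lambda>\<omega>. (X i \<omega>)\<^sup>2)"
    and "\<And>i. i \<in> I \<Longrightarrow> expectation (X i) = 0"
  shows "integrable M (\<lambda>\<omega>. (\<Sum>i\<in>I. X i \<omega>)\<^sup>2)"
    and "expectation (\<lambda>\<omega>. \<Sum>i\<in>I. X i \<omega>) = 0"
    and "expectation (\<lambda>\<omega>. (\<Sum>i\<in>I. X i \<omega>)\<^sup>2) = (\<Sum>i\<in>I. expectation (\<lambda>\<omega>. (X i \<omega>)\<^sup>2))"
proof -
  have "integrable M (\<lambda>\<omega>. (\<Sum>i\<in>I. X i \<omega>)\<^sup>2) \<and>
      expectation (\<lambda>\<omega>. \<Sum>i\<in>I. X i \<omega>) = 0 \<and>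
      expectation (\<lambda>\<omega>. (\<Sum>i\<in>I. X i \<omega>)\<^sup>2) = (\<Sum>i\<in>I. expectation (\<lambda>\<omega>. (X i \<omega>)\<^sup>2))"
    using assms
  proof (induction I rule: finite_induct)
    case empty
    then show ?case by simp
  next
    case (insert j I)
    let ?S = "\<lambda>\<omega>. \<Sum>i\<in>I. X i \<omega>"
    have meas: "X i \<in> borel_measurable M" if "i \<in> insert j I" for i
      using insert.prems(1) that by (auto simp: indep_vars_def)
    \<comment> \<open>The new term is independent of the whole partial sum, so a single cross term
      \<open>X j * ?S\<close> has to be controlled instead of one for each pair.\<close>
    have indep: "indep_var borel (X j) borel ?S"
      using insert.hyps insert.prems(1) by (rule indep_vars_sum)
    have IH: "integrable M (\<lambda>\<omega>. (?S \<omega>)\<^sup>2)" "expectation ?S = 0"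
        "expectation (\<lambda>\<omega>. (?S \<omega>)\<^sup>2) = (\<Sum>i\<in>I. expectation (\<lambda>\<omega>. (X i \<omega>)\<^sup>2))"
      using insert.IH indep_vars_subset[OF insert.prems(1) subset_insertI] insert.prems by auto
    have intj2: "integrable M (\<lambda>\<omega>. (X j \<omega>)\<^sup>2)" and Ej: "expectation (X j) = 0"
      using insert.prems by auto
    have intj: "integrable M (X j)"
      using meas[OF insertI1] intj2 by (rule square_integrable_imp_integrable)
    have intS: "integrable M ?S"
    proof (rule square_integrable_imp_integrable)
      show "?S \<in> borel_measurable M"
        using meas by (intro borel_measurable_sum) blast
    qed (rule IH(1))
    have intp: "integrable M (\<lambda>\<omega>. X j \<omega> * ?S \<omega>)"
      using indep intj intS by (rule indep_var_integrable)
    have Ep: "expectation (\<lambda>\<omega>. X j \<omega> * ?S \<omega>) = 0"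
      using indep_var_lebesgue_integral[OF indep intj intS] Ej by simp
    have sq: "(\<lambda>\<omega>. (\<Sum>i\<in>insert j I. X i \<omega>)\<^sup>2) =
        (\<lambda>\<omega>. (X j \<omega>)\<^sup>2 + (?S \<omega>)\<^sup>2 + 2 * (X j \<omega> * ?S \<omega>))"
      using insert.hyps by (simp add: power2_sum algebra_simps)
    have int_sum: "integrable M (\<lambda>\<omega>. (X j \<omega>)\<^sup>2 + (?S \<omega>)\<^sup>2)"
      using intj2 IH(1) by (rule Bochner_Integration.integrable_add)
    have int_prod: "integrable M (\<lambda>\<omega>. 2 * (X j \<omega> * ?S \<omega>))"
      using intp by (rule integrable_mult_right)
    have "integrable M (\<lambda>\<omega>. (\<Sum>i\<in>insert j I. X i \<omega>)\<^sup>2)"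
      unfolding sq using int_sum int_prod by (rule Bochner_Integration.integrable_add)
    moreover have "expectation (\<lambda>\<omega>. \<Sum>i\<in>insert j I. X i \<omega>) = 0"
      using insert.hyps Bochner_Integration.integral_add[OF intj intS] Ej IH(2) by simp
    moreover have "expectation (\<lambda>\<omega>. (\<Sum>i\<in>insert j I. X i \<omega>)\<^sup>2) =
        (\<Sum>i\<in>insert j I. expectation (\<lambda>\<omega>. (X i \<omega>)\<^sup>2))"
      unfolding sq Bochner_Integration.integral_add[OF int_sum int_prod]
        Bochner_Integration.integral_add[OF intj2 IH(1)]
      using insert.hyps Ep IH(3) by simp
    ultimately show ?case by blast
  qed
  then show "integrable M (\<lambda>\<omega>. (\<Sum>i\<in>I. X i \<omega>)\<^sup>2)"
    and "expectation (\<lambda>\<omega>. \<Sum>i\<in>I. X i \<omega>) = 0"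
    and "expectation (\<lambda>\<omega>. (\<Sum>i\<in>I. X i \<omega>)\<^sup>2) = (\<Sum>i\<in>I. expectation (\<lambda>\<omega>. (X i \<omega>)\<^sup>2))"
    by blast+
qed

text \<open>The weights \<open>1 / card I\<close> add up to one, so the source passes through the
  average unscaled and cancels. This is an identity at a single sample point; \<open>I\<close> must
  be finite and nonempty for \<open>card I\<close> to be nonzero.\<close>

lemma average_of_noise:
  assumes "finite I" and "I \<noteq> {}" and "\<And>i. i \<in> I \<Longrightarrow> ys i \<omega> = v \<omega> + qs i \<omega>"
  shows "fps_nth (average_of I ys \<omega> - v \<omega>) t = (\<Sum>i\<in>I. fps_nth (qs i \<omega>) t) / real (card I)"
proof -
  have "(\<Sum>i\<in>I. ys i \<omega>) = (\<Sum>i\<in>I. v \<omega> + qs i \<omega>)"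
    by (rule sum.cong) (use assms(3) in auto)
  then have "fps_nth (\<Sum>i\<in>I. ys i \<omega>) t
      = real (card I) * fps_nth (v \<omega>) t + (\<Sum>i\<in>I. fps_nth (qs i \<omega>) t)"
    by (simp add: fps_sum_nth sum.distrib)
  then show ?thesis
    using assms(1,2) by (simp add: average_of_def field_simps)
qed

text \<open>The \<open>card I\<close> noises contribute \<open>card I * s\<close> in total, and the
  averaging weight divides this by \<open>(card I)\<^sup>2\<close>. The value is exact at every
  time, not only in the limit.\<close>

lemma independent_encodings_average_variance:
  assumes "prob_space M" and enc: "independent_encodings M k v qs s ys"
    and I: "I \<subseteq> {1..k}" "I \<noteq> {}"
  shows "variance_at M (\<lambda>\<omega>. average_of I ys \<omega> - v \<omega>) t = s / real (card I)"
proof -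
  interpret prob_space M by fact
  let ?X = "\<lambda>i \<omega>. fps_nth (qs i \<omega>) t"
  have fin: "finite I"
    using I(1) by (rule finite_subset) simp
  have X: "integrable M (\<lambda>\<omega>. (?X i \<omega>)\<^sup>2)" "expectation (?X i) = 0"
      "variance_at M (qs i) t = s" if "i \<in> I" for i
    using enc I that by (auto simp: independent_encodings_def)
  have X2: "expectation (\<lambda>\<omega>. (?X i \<omega>)\<^sup>2) = s" if "i \<in> I" for i
    using X(2,3)[OF that] by (simp add: variance_at_def)
  have "indep_vars (\<lambda>_. borel)
      (\<lambda>i \<omega>. if i = 0 then fps_nth (v \<omega>) t else fps_nth (qs i \<omega>) t) {0..k}"
    using enc unfolding independent_encodings_def by blast
  then have "indep_vars (\<lambda>_. borel)
      (\<lambda>i \<omega>. if i = 0 then fps_nth (v \<omega>) t else fps_nth (qs i \<omega>) t) I"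
    using I(1) by (rule indep_vars_subset[OF _ subset_trans]) simp
  \<comment> \<open>Index 0, reserved for the source, lies outside \<open>I\<close>, so the
    conditional always selects a coding noise.\<close>
  also have "?this \<longleftrightarrow> indep_vars (\<lambda>_. borel) ?X I"
    using I by (intro indep_vars_cong) auto
  finally have indep: "indep_vars (\<lambda>_. borel) ?X I" .
  note moments = indep_zero_mean_sum_moments[OF fin indep X(1,2)]
  \<comment> \<open>The descriptions are tied to \<open>v\<close> only on \<open>space M\<close>,
    which is all that congruence of integrals requires.\<close>
  have err: "fps_nth (average_of I ys \<omega> - v \<omega>) t = (\<Sum>i\<in>I. ?X i \<omega>) / real (card I)"
    if "\<omega> \<in> space M" for \<omega>
    using fin I(2)
  proof (rule average_of_noise)
    show "ys i \<omega> = v \<omega> + qs i \<omega>" if "i \<in> I" for i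
      using enc I(1) that \<open>\<omega> \<in> space M\<close> unfolding independent_encodings_def by blast
  qed
  have "expectation (\<lambda>\<omega>. fps_nth (average_of I ys \<omega> - v \<omega>) t)
      = expectation (\<lambda>\<omega>. (\<Sum>i\<in>I. ?X i \<omega>) / real (card I))"
    by (rule Bochner_Integration.integral_cong) (simp_all only: err)
  then have mean: "expectation (\<lambda>\<omega>. fps_nth (average_of I ys \<omega> - v \<omega>) t) = 0"
    by (simp add: moments(2))
  \<comment> \<open>With mean zero the variance is the plain second moment, to which the moment
    lemma applies.\<close>
  have "variance_at M (\<lambda>\<omega>. average_of I ys \<omega> - v \<omega>) t
      = expectation (\<lambda>\<omega>. ((\<Sum>i\<in>I. ?X i \<omega>) / real (card I))\<^sup>2)"
    unfolding variance_at_def mean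
    by (rule Bochner_Integration.integral_cong) (simp_all only: err diff_zero)
  also have "\<dots> = (real (card I) * s) / (real (card I))\<^sup>2"
    by (simp add: power_divide moments(3) X2)
  also have "\<dots> = s / real (card I)"
    using fin I(2) by (simp add: power2_eq_square)
  finally show ?thesis .
qed

text \<open>The error variance is constant in time and hence equals its own limit. For
  \<open>v\<close>, convergence is assumed because \<open>stationary_variance\<close> is a
  \<open>lim\<close>, whose value is determined only when the limit exists.\<close>

lemma independent_encodings_snr:
  assumes "prob_space M" and "independent_encodings M k v qs s ys"
    and "I \<subseteq> {1..k}" and "I \<noteq> {}" and "variance_at M v \<longlonglongrightarrow> sv"
  shows "snr M v (average_of I ys) = real (card I) * sv / s"
proof -
  have "variance_at M (\<lambda>\<omega>. average_of I ys \<omega> - v \<omega>) = (\<lambda>_. s / real (card I))"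
    using independent_encodings_average_variance[OF assms(1-4)] by (rule ext)
  then show ?thesis
    by (simp add: snr_def stationary_variance_def limI[OF assms(5)] limI[OF tendsto_const])
qed

theorem lemma2:
  fixes M :: "'a measure"
    and N :: "('d::finite, 'e::finite) ncs"
    and d :: "'a \<Rightarrow> real fps ^ 'd" and e :: "'a \<Rightarrow> real fps ^ 'e"
    and q y u v w :: "'a \<Rightarrow> real fps"
    and qs ys :: "nat \<Rightarrow> 'a \<Rightarrow> real fps"
    and sigma_v2 sigma_q2 sigma2 :: real
    and R :: "nat \<Rightarrow> real"
    and k k' :: nat
  assumes "prob_space M"
    and "linear_ncs N"
    and "ncs_signals M N d q e y u v w sigma_v2 sigma_q2"
    and "1 \<le> k'" and "k' \<le> k"
    and "independent_encodings M k v qs sigma2 ys"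
    and "stabilizing_code M N k k' v ys"
    and "\<And>j. j \<in> {1..k} \<Longrightarrow> R j \<ge> 1 / 2 * log 2 (1 + sigma_v2 / sigma2)"
  shows "sum_rate k R \<ge>
    real k / 2 * log 2 (1 + (h2_norm_scalar (S_tf N - 1))\<^sup>2 / real k')"
proof -
  let ?c = "(h2_norm_scalar (S_tf N - 1))\<^sup>2 / real k'"
  \<comment> \<open>All selections of \<open>k'\<close> descriptions have the same signal-to-noise
    ratio, so testing the stabilizing condition on the first \<open>k'\<close> loses
    nothing.\<close>
  have "{1..k'} \<subseteq> {1..k}" and "card {1..k'} = k'" and "{1..k'} \<noteq> {}"
    using assms(4,5) by auto
  moreover have "variance_at M v \<longlonglongrightarrow> sigma_v2"
    using assms(3) by (simp add: ncs_signals_def)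
  ultimately have "critical_snr N \<le> real k' * sigma_v2 / sigma2"
    using assms(7) independent_encodings_snr[OF assms(1,6), of "{1..k'}" sigma_v2]
    unfolding stabilizing_code_def by metis
  then have snr: "?c \<le> sigma_v2 / sigma2"
    using assms(4) by (simp add: critical_snr_def field_simps)
  \<comment> \<open>This keeps the smaller argument \<open>1 + ?c\<close> of the logarithm positive,
    as monotonicity demands.\<close>
  have "0 \<le> ?c"
    by simp
  with snr have "log 2 (1 + ?c) \<le> log 2 (1 + sigma_v2 / sigma2)"
    by (intro log_mono) linarith+
  then have "1 / 2 * log 2 (1 + ?c) \<le> R j" if "j \<in> {1..k}" for j
    using assms(8)[OF that] by linarith
  then have "(\<Sum>j = 1..k. 1 / 2 * log 2 (1 + ?c)) \<le> (\<Sum>j = 1..k. R j)"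
    by (rule sum_mono)
  then show ?thesis
    by (simp add: sum_rate_def)
qed

end
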